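(* Let $G$ be a finitely generated group and let $K \subset G$ be a finite generating set. If $G$ is not supramenable, then $$\inf\left\{ \max_{g \in K} |\alpha(g)f-f|_{\infty}^- \;\middle|\; f \in \mathcal{F}(G),\ f(e) = 1\right\} > 0,$$ where $(\alpha(g)f)(g_1) = f(g_1g)$ for $g,g_1\in G$.
   Context: $e$ denotes the neutral element of $G$. $\mathcal{F}(G)$ denotes the set of functions $f:G\to\mathbb{R}$ with finite support. The Macaev norm (Lorentz $(\infty,1)$-norm) of a function $f$ on a set $X$ vanishing at infinity is $$|f|_{\infty}^- = \sum_{k\in\mathbb{N}} f^*(k)\,k^{-1},\qquad \mathbb{N}=\{1,2,3,\dots\},$$ where $f^*(1)\ge f^*(2)\ge\cdots$ is the decreasing rearrangement of $|f|$ (the values $|f(x)|$, $x \in X$, listed in decreasing order with multiplicity, and completed by zeros if necessary); it is finite for finitely supported $f$. A group $G$ is supramenable if for every nonempty subset $A\subset G$ there is a finitely additive measure $\mu$, defined on all subsets of $G$ with values in $[0,\infty]$, which is invariant under left translations and satisfies $\mu(A)=1$. *)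

theory Defs
  imports "HOL-Analysis.Analysis" "HOL-Algebra.Generated_Groups"
begin

text \<open>
  \<open>s\<close> lists the values \<open>\<bar>f x\<bar>\<close>, \<open>x \<in> X\<close>, in decreasing order and with multiplicity: \<open>b\<close> enumerates
  the support of \<open>f\<close> in \<open>X\<close>, and if the support is finite the list is completed by zeros.
  Indices start at \<open>0\<close>, so \<open>s k\<close> is the value usually written \<open>f\<^sup>*(k + 1)\<close>.
\<close>

definition is_decr_rearrangement :: "'a set \<Rightarrow> ('a \<Rightarrow> real) \<Rightarrow> (nat \<Rightarrow> real) \<Rightarrow> bool" where
  "is_decr_rearrangement X f s \<longleftrightarrow>
     decseq s \<and>
     (\<exists>b. bij_betw b {k. s k \<noteq> 0} {x \<in> X. f x \<noteq> 0} \<and> (\<forall>k. s k \<noteq> 0 \<longrightarrow> s k = \<bar>f (b k)\<bar>))"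

text \<open>
  Well-defined when \<open>f\<close> vanishes at infinity on \<open>X\<close>; uniqueness in general, and existence for
  finite support, are proved below.
\<close>

definition decr_rearrangement :: "'a set \<Rightarrow> ('a \<Rightarrow> real) \<Rightarrow> nat \<Rightarrow> real" where
  "decr_rearrangement X f = (THE s. is_decr_rearrangement X f s)"

lemma is_decr_rearrangement_nonneg:
  assumes "is_decr_rearrangement X f s"
  shows "s k \<ge> 0"
proof (cases "s k = 0")
  case False
  with assms have "\<exists>y. s k = \<bar>f y\<bar>" unfolding is_decr_rearrangement_def by blast
  then show ?thesis by auto
qed simp

lemma is_decr_rearrangement_card_ge:
  assumes s: "is_decr_rearrangement X f s" and t: "t > 0"
  obtains b where "bij_betw b {k. s k \<ge> t} {x \<in> X. \<bar>f x\<bar> \<ge> t}"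
proof -
  obtain b where b: "bij_betw b {k. s k \<noteq> 0} {x \<in> X. f x \<noteq> 0}"
    and sb: "\<And>k. s k \<noteq> 0 \<Longrightarrow> s k = \<bar>f (b k)\<bar>"
    using s unfolding is_decr_rearrangement_def by blast
  have "bij_betw b {k. s k \<ge> t} {x \<in> X. \<bar>f x\<bar> \<ge> t}"
  proof (rule bij_betw_subset[OF b])
    show "{k. s k \<ge> t} \<subseteq> {k. s k \<noteq> 0}" using t by auto
    show "b ` {k. s k \<ge> t} = {x \<in> X. \<bar>f x\<bar> \<ge> t}"
    proof (intro equalityI subsetI)
      fix x assume "x \<in> b ` {k. s k \<ge> t}"
      then obtain k where k: "x = b k" "s k \<ge> t" by auto
      with t have "s k \<noteq> 0" by auto
      with k sb[of k] bij_betwE[OF b] show "x \<in> {x \<in> X. \<bar>f x\<bar> \<ge> t}" by auto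
    next
      fix x assume x: "x \<in> {x \<in> X. \<bar>f x\<bar> \<ge> t}"
      with t have "x \<in> {x \<in> X. f x \<noteq> 0}" by auto
      with b obtain k where k: "s k \<noteq> 0" "x = b k" unfolding bij_betw_def by blast
      with x sb[of k] show "x \<in> b ` {k. s k \<ge> t}" by auto
    qed
  qed
  then show thesis by (rule that)
qed

lemma is_decr_rearrangement_unique:
  assumes van: "\<And>t. t > 0 \<Longrightarrow> finite {x \<in> X. \<bar>f x\<bar> \<ge> t}"
    and s: "is_decr_rearrangement X f s" and s': "is_decr_rearrangement X f s'"
  shows "s = s'"
proof -
  have ge: "r k \<ge> t \<longleftrightarrow> k < card {x \<in> X. \<bar>f x\<bar> \<ge> t}"
    if r: "is_decr_rearrangement X f r" and t: "t > 0" for r k t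
  proof -
    obtain b where b: "bij_betw b {k. r k \<ge> t} {x \<in> X. \<bar>f x\<bar> \<ge> t}"
      using is_decr_rearrangement_card_ge[OF r t] .
    have fin: "finite {k. r k \<ge> t}" using bij_betw_finite[OF b] van[OF t] by simp
    have card: "card {k. r k \<ge> t} = card {x \<in> X. \<bar>f x\<bar> \<ge> t}" by (rule bij_betw_same_card[OF b])
    have dec: "decseq r" using r unfolding is_decr_rearrangement_def by simp
    show ?thesis
    proof
      assume "r k \<ge> t"
      then have "{..k} \<subseteq> {k. r k \<ge> t}" using decseqD[OF dec, of _ k] by (auto intro: order_trans)
      from card_mono[OF fin this] show "k < card {x \<in> X. \<bar>f x\<bar> \<ge> t}" using card by simp
    next
      assume less: "k < card {x \<in> X. \<bar>f x\<bar> \<ge> t}"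
      show "r k \<ge> t"
      proof (rule ccontr)
        assume n: "\<not> r k \<ge> t"
        have "{k. r k \<ge> t} \<subseteq> {..<k}"
        proof
          fix j assume "j \<in> {k. r k \<ge> t}"
          then have "\<not> k \<le> j" using n decseqD[OF dec, of k j] by auto
          then show "j \<in> {..<k}" by simp
        qed
        from card_mono[OF _ this] show False using card less by simp
      qed
    qed
  qed
  have "s k \<le> s' k" if "is_decr_rearrangement X f s" "is_decr_rearrangement X f s'" for s s' k
  proof (cases "s k > 0")
    case True
    then show ?thesis using ge[OF that(1) True, of k] ge[OF that(2) True, of k] by simp
  next
    case False
    then show ?thesis using is_decr_rearrangement_nonneg[OF that(2), of k] by simp
  qed
  then show ?thesis using s s' by (intro ext antisym) auto
qed

lemma is_decr_rearrangement_exists: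
  assumes fin: "finite {x \<in> X. f x \<noteq> 0}"
  shows "\<exists>s. is_decr_rearrangement X f s"
proof -
  obtain xs where xs: "set xs = {x \<in> X. f x \<noteq> 0}" "distinct xs"
    using finite_distinct_list[OF fin] by blast
  define l where "l = sort_key (\<lambda>x. - \<bar>f x\<bar>) xs"
  have l: "set l = {x \<in> X. f x \<noteq> 0}" "distinct l" using xs by (simp_all add: l_def)
  have sorted: "sorted (map (\<lambda>x. - \<bar>f x\<bar>) l)" by (simp add: l_def)
  define s where "s k = (if k < length l then \<bar>f (l ! k)\<bar> else 0)" for k
  have supp: "{k. s k \<noteq> 0} = {..<length l}" 
  proof -
    have "f (l ! k) \<noteq> 0" if "k < length l" for k using nth_mem[OF that] unfolding l(1) by simp
    then show ?thesis by (auto simp: s_def)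
  qed
  have "decseq s"
    unfolding decseq_def
  proof (intro allI impI)
    fix m n :: nat assume "m \<le> n"
    then show "s n \<le> s m" using sorted_nth_mono[OF sorted, of m n] by (auto simp: s_def)
  qed
  moreover have "bij_betw ((!) l) {k. s k \<noteq> 0} {x \<in> X. f x \<noteq> 0}"
    using bij_betw_nth[OF l(2), of "{..<length l}"] l(1) supp by simp
  moreover have "\<forall>k. s k \<noteq> 0 \<longrightarrow> s k = \<bar>f (l ! k)\<bar>" by (simp add: s_def)
  ultimately show ?thesis unfolding is_decr_rearrangement_def by blast
qed

lemma is_decr_rearrangement_decr_rearrangement:
  assumes fin: "finite {x \<in> X. f x \<noteq> 0}"
  shows "is_decr_rearrangement X f (decr_rearrangement X f)"
proof -
  have van: "finite {x \<in> X. \<bar>f x\<bar> \<ge> t}" if "t > 0" for t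
    using that by (intro finite_subset[OF _ fin]) auto
  have "\<exists>!s. is_decr_rearrangement X f s"
    using is_decr_rearrangement_exists[OF fin] is_decr_rearrangement_unique[OF van] by blast
  then show ?thesis unfolding decr_rearrangement_def by (rule theI')
qed

definition macaev_norm :: "'a set \<Rightarrow> ('a \<Rightarrow> real) \<Rightarrow> ennreal" where
  "macaev_norm X f = (\<Sum>k. ennreal (decr_rearrangement X f k / real (Suc k)))"

lemma macaev_norm_finite:
  assumes fin: "finite {x \<in> X. f x \<noteq> 0}"
  shows "macaev_norm X f < \<infinity>"
proof -
  let ?s = "decr_rearrangement X f"
  obtain b where b: "bij_betw b {k. ?s k \<noteq> 0} {x \<in> X. f x \<noteq> 0}"
    using is_decr_rearrangement_decr_rearrangement[OF fin]
    unfolding is_decr_rearrangement_def by blast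
  have "finite {k. ?s k \<noteq> 0}" using bij_betw_finite[OF b] fin by simp
  then have "macaev_norm X f = (\<Sum>k\<in>{k. ?s k \<noteq> 0}. ennreal (?s k / real (Suc k)))"
    unfolding macaev_norm_def by (intro suminf_finite) auto
  then show ?thesis by (simp add:
        is_decr_rearrangement_nonneg[OF is_decr_rearrangement_decr_rearrangement[OF fin]])
qed

text \<open>
  Functions on a group \<open>G\<close> are HOL functions on the carrier's type of which only the values on
  \<open>carrier G\<close> matter; everything below is relativised to the carrier.
\<close>

definition finsupp_functions :: "('a, 'm) monoid_scheme \<Rightarrow> ('a \<Rightarrow> real) set" where
  "finsupp_functions G = {f. finite {x \<in> carrier G. f x \<noteq> 0}}"

definition right_translate :: "('a, 'm) monoid_scheme \<Rightarrow> 'a \<Rightarrow> ('a \<Rightarrow> real) \<Rightarrow> 'a \<Rightarrow> real" where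
  "right_translate G g f = (\<lambda>x. f (x \<otimes>\<^bsub>G\<^esub> g))"

definition supramenable :: "('a, 'm) monoid_scheme \<Rightarrow> bool" where
  "supramenable G \<longleftrightarrow>
     (\<forall>A. A \<subseteq> carrier G \<and> A \<noteq> {} \<longrightarrow>
       (\<exists>\<mu> :: 'a set \<Rightarrow> ennreal.
          positive (Pow (carrier G)) \<mu> \<and>
          additive (Pow (carrier G)) \<mu> \<and>
          (\<forall>g \<in> carrier G. \<forall>B \<subseteq> carrier G. \<mu> (g <#\<^bsub>G\<^esub> B) = \<mu> B) \<and>
          \<mu> A = 1))"

end

theory Submission
  imports Defs
begin

text \<open>
  The obstruction comes from sets that expand uniformly. If \<open>A\<close> is a nonempty subset of \<open>G\<close> in which, for
  every finite set \<open>S\<close> of translations and every \<open>\<epsilon> > 0\<close>, some finite nonempty \<open>F \<subseteq> A\<close> satisfies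
  \<open>card (S F \<inter> A - F) \<le> \<epsilon> * card F\<close>, then the normalised counting measures of these \<open>F\<close> accumulate at
  a finitely additive mean on \<open>A\<close> that is invariant under partial translations, and the mean extends
  to an invariant measure on \<open>G\<close> that is \<open>1\<close> on \<open>A\<close>. So a group that is not supramenable has a set \<open>A\<close>,
  a finite \<open>S\<close> and an \<open>\<epsilon> > 0\<close> with \<open>card (S F \<inter> A - F) \<ge> \<epsilon> * card F\<close> for all finite \<open>F \<subseteq> A\<close>
  (\<open>not_supramenable_expanding_subset\<close>).

  On such a set a coarea argument with the weights \<open>1, 1/2, 1/3, \<dots>\<close> applies. List the points of \<open>A\<close> in
  order of decreasing \<open>\<bar>f\<bar>\<close> and give an edge \<open>(x, s x)\<close> the weight \<open>1 / j\<close> if \<open>x\<close> is the \<open>j\<close>-th point.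
  A superlevel set with \<open>n\<close> points is left by at least \<open>\<epsilon> n\<close> edges, and each of them starts in the set
  and therefore has weight at least \<open>1 / n\<close>: the edges leaving a superlevel set weigh at least \<open>\<epsilon>\<close>,
  however large the set is. Integrating over the levels from \<open>0\<close> to \<open>max \<bar>f\<bar>\<close> bounds the weighted
  variation of \<open>f\<close> over the edges below by \<open>\<epsilon> * max \<bar>f\<bar>\<close> (\<open>isoperimetric_weighted_variation\<close>).

  In the other direction, the Macaev norm is exactly what dominates such sums: by the rearrangement
  inequality, \<open>\<Sum> \<bar>h x\<bar> / r x\<close> with distinct positive integers \<open>r x\<close> is at most the norm of \<open>h\<close>
  (\<open>weighted_sum_le_macaev_norm\<close>). As only the distinctness of the ranks matters, the bound survives
  translation, and a telescoping argument along words in \<open>K\<close> passes from the generators to the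
  elements of \<open>S\<close> at the cost of a constant factor (\<open>weighted_variation_le_generate\<close>).

  Expansion is by left translations and the differences are by right translations; the map
  \<open>x \<mapsto> a inv x\<close> with \<open>a \<in> A\<close> exchanges the two and moves \<open>a\<close> to the neutral element, where \<open>f\<close> is \<open>1\<close>.
\<close>

section \<open>Decreasing rearrangements and harmonic weights\<close>

lemma decreasing_enumeration:
  assumes fin: "finite {x \<in> X. f x \<noteq> 0}"
  obtains b N where "\<And>k. decr_rearrangement X f k \<noteq> 0 \<longleftrightarrow> k < N"
    and "bij_betw b {..<N} {x \<in> X. f x \<noteq> 0}"
    and "\<And>k. k < N \<Longrightarrow> decr_rearrangement X f k = \<bar>f (b k)\<bar>"
proof -
  let ?s = "decr_rearrangement X f"
  note s = is_decr_rearrangement_decr_rearrangement[OF fin]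
  obtain b where b: "bij_betw b {k. ?s k \<noteq> 0} {x \<in> X. f x \<noteq> 0}"
    and sb: "\<And>k. ?s k \<noteq> 0 \<Longrightarrow> ?s k = \<bar>f (b k)\<bar>"
    using s unfolding is_decr_rearrangement_def by blast
  have fk: "finite {k. ?s k \<noteq> 0}" using bij_betw_finite[OF b] fin by simp
  have down: "?s j \<noteq> 0" if "?s k \<noteq> 0" "j \<le> k" for j k
    using that s is_decr_rearrangement_nonneg[OF s, of k] decseqD[of ?s j k]
    unfolding is_decr_rearrangement_def by auto
  obtain N where N: "{k. ?s k \<noteq> 0} = {..<N}"
  proof (cases "{k. ?s k \<noteq> 0} = {}")
    case True
    then have "{k. ?s k \<noteq> 0} = {..<0}" by simp
    then show ?thesis by (rule that)
  next
    case False
    define M where "M = Max {k. ?s k \<noteq> 0}"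
    have "?s M \<noteq> 0" using Max_in[OF fk False] by (simp add: M_def)
    moreover have "k \<le> M" if "?s k \<noteq> 0" for k using Max_ge[OF fk] that by (simp add: M_def)
    ultimately have "?s k \<noteq> 0 \<longleftrightarrow> k < Suc M" for k
      using down[of M k] by (meson less_Suc_eq_le)
    then have "{k. ?s k \<noteq> 0} = {..<Suc M}" by blast
    then show ?thesis by (rule that)
  qed
  have iff: "?s k \<noteq> 0 \<longleftrightarrow> k < N" for k using N by blast
  show thesis
  proof (rule that[of N b])
    show "?s k \<noteq> 0 \<longleftrightarrow> k < N" for k by (rule iff)
    show "bij_betw b {..<N} {x \<in> X. f x \<noteq> 0}" using b unfolding N .
    show "?s k = \<bar>f (b k)\<bar>" if "k < N" for k using that by (intro sb iffD2[OF iff])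
  qed
qed

lemma sum_le_sum_lessThan:
  fixes w :: "nat \<Rightarrow> real"
  assumes dec: "decseq w" and nonneg: "\<And>k. 0 \<le> w k"
    and fin: "finite Y" and card: "card Y \<le> m"
  shows "sum w Y \<le> sum w {..<m}"
  using fin card
proof (induction m arbitrary: Y)
  case 0
  then show ?case by simp
next
  case (Suc m)
  show ?case
  proof (cases "card Y \<le> m")
    case True
    then show ?thesis using Suc.IH[OF Suc.prems(1)] nonneg[of m] by fastforce
  next
    case False
    with Suc.prems have c: "card Y = Suc m" by simp
    then have ne: "Y \<noteq> {}" by auto
    define M where "M = Max Y"
    have M: "M \<in> Y" "Y \<subseteq> {..M}" using ne Suc.prems by (auto simp: M_def)
    have "card Y \<le> card {..M}" by (rule card_mono) (use M in auto)
    with c have "m \<le> M" by simp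
    then have "w M \<le> w m" by (rule decseqD[OF dec])
    moreover have "sum w (Y - {M}) \<le> sum w {..<m}"
      by (rule Suc.IH) (use Suc.prems c M in auto)
    moreover have "sum w Y = w M + sum w (Y - {M})"
      using M Suc.prems by (simp add: sum.remove)
    ultimately show ?thesis by simp
  qed
qed

lemma decrement_sum:
  fixes s :: "nat \<Rightarrow> real"
  assumes "i \<le> l"
  shows "(\<Sum>m = i..<l. s m - s (Suc m)) = s i - s l"
  using sum_Suc_diff'[OF assms, of "\<lambda>k. - s k"] by simp

text \<open>
  The discrete layer cake formula: \<open>s i\<close> is the sum of the decrements of \<open>s\<close> from \<open>i\<close> on, so a sum with
  coefficients \<open>s (p x)\<close> is a combination of sums over the sublevel sets of \<open>p\<close>, with nonnegative
  coefficients as soon as \<open>s\<close> is decreasing.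
\<close>

lemma layer_cake_sum:
  fixes s :: "nat \<Rightarrow> real"
  assumes s0: "\<And>k. N \<le> k \<Longrightarrow> s k = 0"
  shows "(\<Sum>x\<in>Y. s (p x) * v x) =
    (\<Sum>m<N. (s m - s (Suc m)) * (\<Sum>x\<in>Y. of_bool (p x \<le> m) * v x))"
proof -
  have layer: "s i = (\<Sum>m<N. (s m - s (Suc m)) * of_bool (i \<le> m))" for i
  proof (cases "i \<le> N")
    case True
    have "(\<Sum>m<N. (s m - s (Suc m)) * of_bool (i \<le> m)) = (\<Sum>m = i..<N. s m - s (Suc m))"
      by (rule sum.mono_neutral_cong_right) auto
    then show ?thesis using decrement_sum[OF True, of s] s0[of N] by simp
  qed (use s0 in \<open>auto intro!: sum.neutral[symmetric]\<close>)
  have "(\<Sum>x\<in>Y. s (p x) * v x) =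
    (\<Sum>x\<in>Y. \<Sum>m<N. (s m - s (Suc m)) * (of_bool (p x \<le> m) * v x))"
    by (subst layer) (simp only: sum_distrib_right mult.assoc)
  also have "\<dots> = (\<Sum>m<N. \<Sum>x\<in>Y. (s m - s (Suc m)) * (of_bool (p x \<le> m) * v x))"
    by (rule sum.swap)
  finally show ?thesis by (simp only: sum_distrib_left)
qed

text \<open>
  By the layer cake formula it suffices to compare the sums over \<open>{x. p x \<le> m}\<close>. This set has at most
  \<open>m + 1\<close> elements, so its \<open>w\<close>-sum is at most that of the \<open>m + 1\<close> largest weights.
\<close>

lemma rearrangement_inequality:
  fixes s w :: "nat \<Rightarrow> real"
  assumes s: "decseq s" and s0: "\<And>k. N \<le> k \<Longrightarrow> s k = 0"
    and w: "decseq w" and w0: "\<And>k. 0 \<le> w k"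
    and fin: "finite X" and inj: "inj_on p X" "inj_on r X"
  shows "(\<Sum>x\<in>X. s (p x) * w (r x)) \<le> (\<Sum>k<N. s k * w k)"
proof -
  have low: "(\<Sum>x\<in>X. of_bool (p x \<le> m) * w (r x)) \<le> (\<Sum>k<N. of_bool (k \<le> m) * w k)"
    if "m < N" for m
  proof -
    let ?Y = "{x \<in> X. p x \<le> m}"
    have "card (p ` ?Y) \<le> card {..m}" by (rule card_mono) auto
    moreover have "card (p ` ?Y) = card (r ` ?Y)"
      using inj by (simp add: card_image inj_on_subset)
    ultimately have c: "card (r ` ?Y) \<le> Suc m" by simp
    have "(\<Sum>x\<in>X. of_bool (p x \<le> m) * w (r x)) = (\<Sum>x\<in>?Y. w (r x))"
      using fin by (intro sum.mono_neutral_cong_right) auto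
    also have "\<dots> = sum w (r ` ?Y)"
      using inj by (simp add: sum.reindex inj_on_subset)
    also have "\<dots> \<le> sum w {..<Suc m}"
      by (rule sum_le_sum_lessThan[OF w w0 _ c]) (use fin in simp)
    also have "\<dots> = (\<Sum>k<N. of_bool (k \<le> m) * w k)"
      using that by (intro sum.mono_neutral_cong_left) auto
    finally show ?thesis .
  qed
  have "(\<Sum>x\<in>X. s (p x) * w (r x)) =
    (\<Sum>m<N. (s m - s (Suc m)) * (\<Sum>x\<in>X. of_bool (p x \<le> m) * w (r x)))"
    by (rule layer_cake_sum[OF s0])
  also have "\<dots> \<le> (\<Sum>m<N. (s m - s (Suc m)) * (\<Sum>k<N. of_bool (k \<le> m) * w k))"
    using low decseq_SucD[OF s] by (intro sum_mono mult_left_mono) auto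
  also have "\<dots> = (\<Sum>k<N. s k * w k)"
    by (rule layer_cake_sum[OF s0, where p = "\<lambda>k. k", symmetric])
  finally show ?thesis .
qed

text \<open>
  The Macaev norm dominates every pairing of \<open>\<bar>f\<bar>\<close> with the harmonic weights, whatever the order in which
  the weights are distributed: the decreasing order, which defines the norm, pairs best.
\<close>

lemma weighted_sum_le_macaev_norm:
  assumes fin: "finite {x \<in> Z. f x \<noteq> 0}"
    and X: "finite X" "X \<subseteq> Z" and r: "inj_on (r :: 'a \<Rightarrow> nat) X"
  shows "ennreal (\<Sum>x\<in>X. \<bar>f x\<bar> / real (Suc (r x))) \<le> macaev_norm Z f"
proof -
  let ?s = "decr_rearrangement Z f"
  obtain b N where N: "\<And>k. ?s k \<noteq> 0 \<longleftrightarrow> k < N"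
    and b: "bij_betw b {..<N} {x \<in> Z. f x \<noteq> 0}"
    and sb: "\<And>k. k < N \<Longrightarrow> ?s k = \<bar>f (b k)\<bar>"
    by (rule decreasing_enumeration[OF fin]) (rule that)
  note s = is_decr_rearrangement_decr_rearrangement[OF fin]
  define Y where "Y = {x \<in> X. f x \<noteq> 0}"
  define p where "p = inv_into {..<N} b"
  have p: "p x < N" "b (p x) = x" if "x \<in> Y" for x
  proof -
    have "x \<in> b ` {..<N}" using that X b by (auto simp: Y_def bij_betw_def)
    then show "p x < N" "b (p x) = x"
      unfolding p_def using inv_into_into[of x b "{..<N}"] f_inv_into_f[of x b "{..<N}"] by simp_all
  qed
  have "(\<Sum>x\<in>X. \<bar>f x\<bar> / real (Suc (r x))) = (\<Sum>x\<in>Y. ?s (p x) * (1 / real (Suc (r x))))"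
    using X sb p by (intro sum.mono_neutral_cong_right) (auto simp: Y_def)
  also have "\<dots> \<le> (\<Sum>k<N. ?s k * (1 / real (Suc k)))"
  proof (rule rearrangement_inequality)
    show "decseq ?s" using s unfolding is_decr_rearrangement_def by blast
    show "decseq (\<lambda>k. 1 / real (Suc k))" by (auto simp: decseq_def frac_le)
    show "inj_on p Y" using p by (metis inj_onI)
    show "inj_on r Y" using r by (auto simp: Y_def inj_on_def)
    show "?s k = 0" if "N \<le> k" for k using N[of k] that by simp
    show "finite Y" using X by (simp add: Y_def)
  qed simp
  finally have "ennreal (\<Sum>x\<in>X. \<bar>f x\<bar> / real (Suc (r x))) \<le> ennreal (\<Sum>k<N. ?s k / real (Suc k))"
    by (simp add: ennreal_leI)
  also have "\<dots> = (\<Sum>k<N. ennreal (?s k / real (Suc k)))"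
    using is_decr_rearrangement_nonneg[OF s] by (simp add: sum_ennreal)
  also have "\<dots> \<le> macaev_norm Z f"
    unfolding macaev_norm_def by (rule sum_le_suminf) auto
  finally show ?thesis .
qed

section \<open>Weighted variation on expanding sets\<close>

text \<open>
  The coarea argument. The ranking \<open>r\<close> lists the points of \<open>A\<close> by decreasing \<open>\<bar>f\<bar>\<close>, so that the first
  \<open>m + 1\<close> points form a superlevel set \<open>F m\<close>, unless the next point has the same value; but then the
  decrement \<open>d m\<close> vanishes and level \<open>m\<close> does not count. The drop of \<open>\<bar>f\<bar>\<close> along an edge is the sum of the decrements
  \<open>d m\<close> over the levels that the edge crosses, that is, those \<open>m\<close> at which it leads out of \<open>F m\<close>. At level \<open>m\<close> at
  least \<open>\<epsilon> * (m + 1)\<close> edges cross, each of weight at least \<open>1 / (m + 1)\<close>, which gives \<open>\<epsilon>\<close> in total,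
  independently of \<open>m\<close>. Summation over \<open>m\<close> telescopes to \<open>\<epsilon>\<close> times the maximum of \<open>\<bar>f\<bar>\<close> on \<open>A\<close>.
\<close>

lemma isoperimetric_weighted_variation:
  fixes A :: "'a set" and f :: "'a \<Rightarrow> real" and T :: "'t \<Rightarrow> 'a \<Rightarrow> 'a"
  assumes fS: "finite S" and fin: "finite {x \<in> A. f x \<noteq> 0}" and a: "a \<in> A"
    and eps: "0 \<le> \<epsilon>"
    and iso: "\<And>F. \<lbrakk>finite F; F \<noteq> {}; F \<subseteq> A\<rbrakk> \<Longrightarrow>
      \<epsilon> * real (card F) \<le> real (card ((\<Union>t\<in>S. T t ` F) \<inter> A - F))"
  obtains r :: "'a \<Rightarrow> nat" where "inj_on r {x \<in> A. f x \<noteq> 0}"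
    and "\<epsilon> * \<bar>f a\<bar> \<le>
      (\<Sum>t\<in>S. \<Sum>x | x \<in> A \<and> f x \<noteq> 0. \<bar>f (T t x) - f x\<bar> / real (Suc (r x)))"
proof -
  let ?s = "decr_rearrangement A f" and ?X = "{x \<in> A. f x \<noteq> 0}"
  obtain b N where N: "\<And>k. ?s k \<noteq> 0 \<longleftrightarrow> k < N" and b: "bij_betw b {..<N} ?X"
    and sb: "\<And>k. k < N \<Longrightarrow> ?s k = \<bar>f (b k)\<bar>"
    by (rule decreasing_enumeration[OF fin]) (rule that)
  have dec: "decseq ?s"
    using is_decr_rearrangement_decr_rearrangement[OF fin]
    unfolding is_decr_rearrangement_def by blast
  have sN: "?s N = 0" using N by blast
  have bA: "b i \<in> A" if "i < N" for i using b that by (auto simp: bij_betw_def)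
  have bin: "b i = b j \<longleftrightarrow> i = j" if "i < N" "j < N" for i j
    using b that by (auto simp: bij_betw_def inj_on_def)
  have bX: "\<exists>i<N. b i = y" if "y \<in> A" "f y \<noteq> 0" for y
  proof -
    have "y \<in> b ` {..<N}" using b that by (simp add: bij_betw_def)
    then show ?thesis by auto
  qed
  define r where "r = inv_into {..<N} b"
  have rb: "r (b i) = i" if "i < N" for i
    using b that unfolding r_def by (simp add: bij_betw_def)
  have r: "inj_on r ?X"
    using b bij_betw_inv_into[OF b] by (simp add: r_def bij_betw_def)
  define d where "d m = ?s m - ?s (Suc m)" for m
  have d0: "0 \<le> d m" for m using decseq_SucD[OF dec] by (simp add: d_def)
  define F where "F m = b ` {..m}" for m
  \<comment> \<open>The edge from \<open>b i\<close> along \<open>T t\<close> crosses level \<open>m\<close>.\<close>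
  define c where "c t i m \<longleftrightarrow> i \<le> m \<and> T t (b i) \<in> A - F m" for t i m
  have jump: "(\<Sum>m<N. d m * of_bool (c t i m)) \<le> \<bar>f (T t (b i)) - f (b i)\<bar>"
    if i: "i < N" for t i
  proof (cases "T t (b i) \<in> A")
    case True
    define y where "y = T t (b i)"
    \<comment> \<open>\<open>l\<close> is the position of \<open>y\<close> in the enumeration; points where \<open>f\<close> vanishes come last, at \<open>N\<close>.\<close>
    obtain l where l: "l \<le> N" "?s l = \<bar>f y\<bar>" "\<And>m. m < N \<Longrightarrow> y \<in> F m \<longleftrightarrow> l \<le> m"
    proof (cases "f y = 0")
      case True
      have "y \<notin> F m" if m: "m < N" for m
      proof
        assume "y \<in> F m"
        then obtain j where "j \<le> m" "y = b j" unfolding F_def by blast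
        then show False using m sb[of j] N[of j] True by simp
      qed
      then show ?thesis using that[of N] sN True by auto
    next
      case False
      with bX[of y] \<open>T t (b i) \<in> A\<close> obtain l where l: "l < N" "b l = y"
        unfolding y_def by blast
      have "y \<in> F m \<longleftrightarrow> l \<le> m" if m: "m < N" for m
      proof -
        have "y \<in> F m \<longleftrightarrow> (\<exists>j\<le>m. b l = b j)" unfolding F_def l(2) by auto
        also have "\<dots> \<longleftrightarrow> l \<le> m" using bin[OF l(1)] m le_less_trans by blast
        finally show ?thesis .
      qed
      then show ?thesis using that[of l] l sb by auto
    qed
    have "(\<Sum>m<N. d m * of_bool (c t i m)) = (\<Sum>m = i..<l. d m)"
      using l True by (intro sum.mono_neutral_cong_right) (auto simp: c_def y_def)
    also have "\<dots> \<le> \<bar>?s l - ?s i\<bar>"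
      using decrement_sum[of i l ?s] by (cases "i \<le> l") (auto simp: d_def)
    also have "\<dots> \<le> \<bar>f y - f (b i)\<bar>"
      unfolding l(2) sb[OF i] by (rule abs_triangle_ineq3)
    finally show ?thesis unfolding y_def .
  qed (simp add: c_def)
  have level: "\<epsilon> \<le> (\<Sum>t\<in>S. \<Sum>i<N. of_bool (c t i m) / real (Suc i))" if m: "m < N" for m
  proof -
    let ?P = "{p \<in> S \<times> {..<N}. c (fst p) (snd p) m}"
    have finP: "finite ?P" using fS by simp
    have "card (F m) = Suc m"
      unfolding F_def by (subst card_image) (use bin m in \<open>auto simp: inj_on_def\<close>)
    moreover have "\<epsilon> * real (card (F m)) \<le> real (card ((\<Union>t\<in>S. T t ` F m) \<inter> A - F m))"
      by (rule iso) (use bA m in \<open>auto simp: F_def\<close>)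
    moreover have "card ((\<Union>t\<in>S. T t ` F m) \<inter> A - F m) \<le> card ?P"
    proof -
      have "(\<Union>t\<in>S. T t ` F m) \<inter> A - F m \<subseteq> (\<lambda>p. T (fst p) (b (snd p))) ` ?P"
      proof
        fix y assume y: "y \<in> (\<Union>t\<in>S. T t ` F m) \<inter> A - F m"
        then obtain t i where "t \<in> S" "i \<le> m" "y = T t (b i)" unfolding F_def by blast
        with y m have "(t, i) \<in> ?P" "y = (\<lambda>p. T (fst p) (b (snd p))) (t, i)"
          by (auto simp: c_def)
        then show "y \<in> (\<lambda>p. T (fst p) (b (snd p))) ` ?P" by blast
      qed
      then show ?thesis by (rule surj_card_le[OF finP])
    qed
    ultimately have "\<epsilon> * real (Suc m) \<le> real (card ?P)" by simp
    then have "\<epsilon> \<le> real (card ?P) / real (Suc m)" by (simp add: field_simps)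
    also have "\<dots> = (\<Sum>p\<in>?P. 1 / real (Suc m))" by simp
    also have "\<dots> = (\<Sum>p\<in>S \<times> {..<N}. of_bool (c (fst p) (snd p) m) / real (Suc m))"
      using fS by (intro sum.mono_neutral_cong_left) auto
    also have "\<dots> \<le> (\<Sum>p\<in>S \<times> {..<N}. of_bool (c (fst p) (snd p) m) / real (Suc (snd p)))"
      by (intro sum_mono) (auto simp: c_def frac_le)
    also have "\<dots> = (\<Sum>t\<in>S. \<Sum>i<N. of_bool (c t i m) / real (Suc i))"
      by (simp add: sum.cartesian_product case_prod_unfold)
    finally show ?thesis .
  qed
  have "\<bar>f a\<bar> \<le> ?s 0"
  proof (cases "f a = 0")
    case True
    have "?s N \<le> ?s 0" by (rule decseqD[OF dec]) simp
    then show ?thesis using True sN by simp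
  next
    case False
    then obtain i where "i < N" "b i = a" using bX a by blast
    then show ?thesis using sb[of i] decseqD[OF dec, of 0 i] by simp
  qed
  have "\<epsilon> * \<bar>f a\<bar> \<le> \<epsilon> * ?s 0" using eps \<open>\<bar>f a\<bar> \<le> ?s 0\<close> by (rule mult_left_mono[rotated])
  also have "\<dots> = (\<Sum>m<N. d m * \<epsilon>)"
    using decrement_sum[of 0 N ?s] sN
    by (simp add: d_def atLeast0LessThan sum_distrib_right[symmetric])
  also have "\<dots> \<le> (\<Sum>m<N. d m * (\<Sum>t\<in>S. \<Sum>i<N. of_bool (c t i m) / real (Suc i)))"
    by (intro sum_mono mult_left_mono level d0) auto
  also have "\<dots> = (\<Sum>t\<in>S. \<Sum>i<N. (\<Sum>m<N. d m * of_bool (c t i m)) / real (Suc i))"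
  proof -
    have "(\<Sum>m<N. d m * (\<Sum>t\<in>S. \<Sum>i<N. of_bool (c t i m) / real (Suc i))) =
      (\<Sum>m<N. \<Sum>t\<in>S. \<Sum>i<N. d m * of_bool (c t i m) / real (Suc i))"
      by (simp add: sum_distrib_left)
    also have "\<dots> = (\<Sum>t\<in>S. \<Sum>m<N. \<Sum>i<N. d m * of_bool (c t i m) / real (Suc i))"
      by (rule sum.swap)
    also have "\<dots> = (\<Sum>t\<in>S. \<Sum>i<N. \<Sum>m<N. d m * of_bool (c t i m) / real (Suc i))"
      by (intro sum.cong refl sum.swap)
    finally show ?thesis by (simp only: sum_divide_distrib)
  qed
  also have "\<dots> \<le> (\<Sum>t\<in>S. \<Sum>i<N. \<bar>f (T t (b i)) - f (b i)\<bar> / real (Suc i))"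
    by (intro sum_mono divide_right_mono jump) auto
  also have "\<dots> = (\<Sum>t\<in>S. \<Sum>x\<in>?X. \<bar>f (T t x) - f x\<bar> / real (Suc (r x)))"
  proof (rule sum.cong[OF refl])
    fix t
    show "(\<Sum>i<N. \<bar>f (T t (b i)) - f (b i)\<bar> / real (Suc i)) =
      (\<Sum>x\<in>?X. \<bar>f (T t x) - f x\<bar> / real (Suc (r x)))"
      by (subst sum.reindex_bij_betw[OF b, symmetric]) (auto intro!: sum.cong simp: rb)
  qed
  finally show thesis by (rule that[OF r])
qed

section \<open>Weighted variation along words in the generators\<close>

text \<open>
  All injective rankings \<open>r\<close> of all finite sets are allowed. This makes the bound invariant under
  translations of the group, hence subadditive in \<open>g\<close>; it replaces the triangle inequality and the
  translation invariance of the Macaev norm.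
\<close>

definition weighted_variation_le ::
    "('a, 'm) monoid_scheme \<Rightarrow> ('a \<Rightarrow> real) \<Rightarrow> 'a \<Rightarrow> ennreal \<Rightarrow> bool" where
  "weighted_variation_le G f g c \<longleftrightarrow>
     (\<forall>X. \<forall>r :: 'a \<Rightarrow> nat. finite X \<longrightarrow> X \<subseteq> carrier G \<longrightarrow> inj_on r X \<longrightarrow>
       ennreal (\<Sum>x\<in>X. \<bar>f (x \<otimes>\<^bsub>G\<^esub> g) - f x\<bar> / real (Suc (r x))) \<le> c)"

context group
begin

lemma inj_on_right_translation: "g \<in> carrier G \<Longrightarrow> X \<subseteq> carrier G \<Longrightarrow> inj_on (\<lambda>x. x \<otimes> g) X"
  by (auto simp: inj_on_def subset_iff)

text \<open>
  Carrying the ranking along a right translation turns sums over \<open>X\<close> into sums over \<open>X g\<close>.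
\<close>

lemma weighted_sum_right_translate:
  assumes g: "g \<in> carrier G" and X: "finite X" "X \<subseteq> carrier G" and r: "inj_on (r :: 'a \<Rightarrow> nat) X"
  obtains X' and r' :: "'a \<Rightarrow> nat" where "finite X'" "X' \<subseteq> carrier G" "inj_on r' X'"
    and "\<And>h :: 'a \<Rightarrow> real.
      (\<Sum>x\<in>X'. h x / real (Suc (r' x))) = (\<Sum>x\<in>X. h (x \<otimes> g) / real (Suc (r x)))"
proof -
  define r' where "r' y = r (y \<otimes> inv g)" for y
  have r'g: "r' (x \<otimes> g) = r x" if "x \<in> X" for x
    using that g X by (auto simp: r'_def m_assoc)
  show thesis
  proof (rule that[of "(\<lambda>x. x \<otimes> g) ` X" r'])
    show "inj_on r' ((\<lambda>x. x \<otimes> g) ` X)" using r by (auto simp: inj_on_def r'g)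
    show "(\<Sum>x\<in>(\<lambda>x. x \<otimes> g) ` X. h x / real (Suc (r' x))) =
        (\<Sum>x\<in>X. h (x \<otimes> g) / real (Suc (r x)))" for h :: "'a \<Rightarrow> real"
      by (subst sum.reindex[OF inj_on_right_translation[OF g X(2)]])
         (auto intro!: sum.cong simp: r'g)
  qed (use X g in auto)
qed

lemma weighted_variation_le_macaev_norm:
  assumes f: "f \<in> finsupp_functions G" and g: "g \<in> carrier G"
  shows "weighted_variation_le G f g
    (macaev_norm (carrier G) (\<lambda>x. right_translate G g f x - f x))"
proof -
  let ?S = "{x \<in> carrier G. f x \<noteq> 0}"
  have "{x \<in> carrier G. right_translate G g f x - f x \<noteq> 0} \<subseteq> ?S \<union> (\<lambda>y. y \<otimes> inv g) ` ?S"
  proof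
    fix x assume x: "x \<in> {x \<in> carrier G. right_translate G g f x - f x \<noteq> 0}"
    then have xc: "x \<in> carrier G" by simp
    show "x \<in> ?S \<union> (\<lambda>y. y \<otimes> inv g) ` ?S"
    proof (cases "f x = 0")
      case True
      then have "x \<otimes> g \<in> ?S" using x g by (auto simp: right_translate_def)
      moreover have "x = (x \<otimes> g) \<otimes> inv g" using xc g by (simp add: m_assoc)
      ultimately show ?thesis by blast
    qed (use xc in simp)
  qed
  moreover have "finite ?S" using f by (simp add: finsupp_functions_def)
  ultimately have "finite {x \<in> carrier G. right_translate G g f x - f x \<noteq> 0}"
    by (meson finite_UnI finite_imageI finite_subset)
  from weighted_sum_le_macaev_norm[OF this] show ?thesis
    unfolding weighted_variation_le_def right_translate_def by blast
qed

lemma weighted_variation_le_inv: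
  assumes c: "weighted_variation_le G f g c" and g: "g \<in> carrier G"
  shows "weighted_variation_le G f (inv g) c"
  unfolding weighted_variation_le_def
proof (intro allI impI)
  fix X and r :: "'a \<Rightarrow> nat"
  assume X: "finite X" "X \<subseteq> carrier G" "inj_on r X"
  obtain X' and r' :: "'a \<Rightarrow> nat" where X': "finite X'" "X' \<subseteq> carrier G" "inj_on r' X'"
    and sum: "\<And>h :: 'a \<Rightarrow> real.
      (\<Sum>x\<in>X'. h x / real (Suc (r' x))) = (\<Sum>x\<in>X. h (x \<otimes> inv g) / real (Suc (r x)))"
    by (rule weighted_sum_right_translate[OF inv_closed[OF g] X]) (rule that)
  have "(\<Sum>x\<in>X. \<bar>f (x \<otimes> inv g) - f x\<bar> / real (Suc (r x))) =
      (\<Sum>x\<in>X. \<bar>f ((x \<otimes> inv g) \<otimes> g) - f (x \<otimes> inv g)\<bar> / real (Suc (r x)))"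
    using X g by (intro sum.cong) (auto simp: m_assoc subset_iff)
  also have "\<dots> = (\<Sum>x\<in>X'. \<bar>f (x \<otimes> g) - f x\<bar> / real (Suc (r' x)))"
    by (rule sum[symmetric])
  finally show "ennreal (\<Sum>x\<in>X. \<bar>f (x \<otimes> inv g) - f x\<bar> / real (Suc (r x))) \<le> c"
    using c X' unfolding weighted_variation_le_def by simp
qed

lemma weighted_variation_le_mult:
  assumes c: "weighted_variation_le G f g c" and d: "weighted_variation_le G f h d"
    and g: "g \<in> carrier G" and h: "h \<in> carrier G"
  shows "weighted_variation_le G f (g \<otimes> h) (c + d)"
  unfolding weighted_variation_le_def
proof (intro allI impI)
  fix X and r :: "'a \<Rightarrow> nat"
  assume X: "finite X" "X \<subseteq> carrier G" "inj_on r X"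
  obtain X' and r' :: "'a \<Rightarrow> nat" where X': "finite X'" "X' \<subseteq> carrier G" "inj_on r' X'"
    and sum: "\<And>u :: 'a \<Rightarrow> real.
      (\<Sum>x\<in>X'. u x / real (Suc (r' x))) = (\<Sum>x\<in>X. u (x \<otimes> g) / real (Suc (r x)))"
    by (rule weighted_sum_right_translate[OF g X]) (rule that)
  let ?V = "\<lambda>g. \<Sum>x\<in>X. \<bar>f (x \<otimes> g) - f x\<bar> / real (Suc (r x))"
  let ?W = "\<Sum>x\<in>X'. \<bar>f (x \<otimes> h) - f x\<bar> / real (Suc (r' x))"
  have "?V (g \<otimes> h) \<le>
      (\<Sum>x\<in>X. \<bar>f (x \<otimes> g) - f x\<bar> / real (Suc (r x)) +
             \<bar>f ((x \<otimes> g) \<otimes> h) - f (x \<otimes> g)\<bar> / real (Suc (r x)))"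
    unfolding add_divide_distrib[symmetric]
    using X g h by (intro sum_mono divide_right_mono) (auto simp: m_assoc subset_iff)
  also have "\<dots> = ?V g + ?W" by (simp only: sum.distrib sum)
  finally have "ennreal (?V (g \<otimes> h)) \<le> ennreal (?V g + ?W)" by (rule ennreal_leI)
  also have "\<dots> = ennreal (?V g) + ennreal ?W"
    by (intro ennreal_plus sum_nonneg) auto
  also have "\<dots> \<le> c + d"
    using c d X X' unfolding weighted_variation_le_def by (intro add_mono) auto
  finally show "ennreal (?V (g \<otimes> h)) \<le> c + d" .
qed

text \<open>
  The constant \<open>L\<close> is the length of a word for \<open>s\<close> in the generators and their inverses. It has to be
  chosen before \<open>f\<close> and \<open>M\<close>, since the final lower bound must be uniform in \<open>f\<close>.
\<close>

lemma weighted_variation_le_generate: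
  assumes K: "K \<subseteq> carrier G" and s: "s \<in> generate G K"
  shows "\<exists>L :: nat. \<forall>f M. (\<forall>k\<in>K. weighted_variation_le G f k M) \<longrightarrow>
    weighted_variation_le G f s (of_nat L * M)"
  using s
proof (induction rule: generate.induct)
  case one
  have "weighted_variation_le G f \<one> 0" for f
    unfolding weighted_variation_le_def by (auto simp: subset_iff intro!: sum.neutral)
  then show ?case by (intro exI[of _ 0]) simp
next
  case (incl k)
  then show ?case by (intro exI[of _ 1]) auto
next
  case (inv k)
  then show ?case using K by (intro exI[of _ 1]) (auto intro: weighted_variation_le_inv)
next
  case (eng g h)
  then obtain L L' :: nat
    where "\<forall>f M. (\<forall>k\<in>K. weighted_variation_le G f k M) \<longrightarrow>
        weighted_variation_le G f g (of_nat L * M)"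
      and "\<forall>f M. (\<forall>k\<in>K. weighted_variation_le G f k M) \<longrightarrow>
        weighted_variation_le G f h (of_nat L' * M)" by blast
  moreover have "g \<in> carrier G" "h \<in> carrier G"
    using eng generate_in_carrier[OF K] by auto
  ultimately show ?case
    by (intro exI[of _ "L + L'"]) (auto simp: distrib_right intro: weighted_variation_le_mult)
qed

end

section \<open>Invariant measures and expanding sets\<close>

context group
begin

lemma l_coset_eq_left_translate: "l_coset G g B = (\<otimes>) g ` B"
  by (auto simp: l_coset_def)

lemma left_translate_twice:
  "\<lbrakk>M \<subseteq> carrier G; g \<in> carrier G; h \<in> carrier G\<rbrakk> \<Longrightarrow>
    (\<otimes>) g ` (\<otimes>) h ` M = (\<otimes>) (g \<otimes> h) ` M"
  by (force simp: m_assoc)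

lemma left_translate_one: "M \<subseteq> carrier G \<Longrightarrow> (\<otimes>) \<one> ` M = M"
  by force

lemma inj_on_left_translation: "g \<in> carrier G \<Longrightarrow> X \<subseteq> carrier G \<Longrightarrow> inj_on ((\<otimes>) g) X"
  by (auto simp: inj_on_def subset_iff)

text \<open>
  For each pair of a finite set \<open>S\<close> and an \<open>\<epsilon> > 0\<close>, the means on \<open>A\<close> that are invariant up to \<open>\<epsilon>\<close> under
  partial translations by \<open>S\<close> form a closed set in the product space of all functions from sets to
  \<open>[0, 1]\<close>. Normalised counting on a set \<open>F\<close> with small boundary belongs to it: translating \<open>B \<inter> F\<close> by
  \<open>g \<in> S\<close> inside \<open>A\<close> loses only points that land in the boundary of \<open>F\<close>. The pairs are directed, so
  these sets have the finite intersection property, and by Tychonoff's theorem they have a common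
  element. One-sided approximate invariance suffices because \<open>g\<close> and its inverse are both available
  in the limit.
\<close>

lemma partially_invariant_mean:
  assumes A: "A \<subseteq> carrier G"
    and folner: "\<And>S \<epsilon>. \<lbrakk>finite S; S \<subseteq> carrier G; \<epsilon> > 0\<rbrakk> \<Longrightarrow>
      \<exists>F. finite F \<and> F \<noteq> {} \<and> F \<subseteq> A \<and>
        real (card ((\<Union>s\<in>S. (\<otimes>) s ` F) \<inter> A - F)) \<le> \<epsilon> * real (card F)"
  obtains m :: "'a set \<Rightarrow> real" where "\<And>B. 0 \<le> m B" and "m A = 1"
    and "\<And>B C. B \<inter> C = {} \<Longrightarrow> m (B \<union> C) = m B + m C"
    and "\<And>g B. \<lbrakk>g \<in> carrier G; B \<subseteq> A; (\<otimes>) g ` B \<subseteq> A\<rbrakk> \<Longrightarrow> m ((\<otimes>) g ` B) = m B"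
proof -
  define U :: "('a set \<Rightarrow> real) set" where "U = (\<Pi>\<^sub>E B\<in>UNIV. {0..1})"
  define I :: "('a set \<times> real) set" where "I = {(S, \<epsilon>). finite S \<and> S \<subseteq> carrier G \<and> \<epsilon> > 0}"
  define C :: "'a set \<times> real \<Rightarrow> ('a set \<Rightarrow> real) set" where
    "C p = {m. m A = 1 \<and> (\<forall>B B'. B \<inter> B' = {} \<longrightarrow> m (B \<union> B') = m B + m B') \<and>
      (\<forall>g B. g \<in> fst p \<and> B \<subseteq> A \<and> (\<otimes>) g ` B \<subseteq> A \<longrightarrow> m B \<le> m ((\<otimes>) g ` B) + snd p)}" for p
  have "compact U"
  proof -
    have "compactin (product_topology (\<lambda>i. euclidean) UNIV) U"
      unfolding U_def compactin_PiE by (auto simp: compactin_euclidean_iff)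
    then show ?thesis by (simp add: euclidean_product_topology compactin_euclidean_iff)
  qed
  moreover have "closed (C p)" for p
    unfolding C_def
    by (intro closed_Collect_conj closed_Collect_all closed_Collect_imp closed_Collect_eq
        closed_Collect_le open_Collect_const continuous_intros continuous_on_product_coordinates)
  moreover have "U \<inter> (\<Inter>p\<in>J. C p) \<noteq> {}" if J: "finite J" "J \<subseteq> I" for J
  proof -
    define S where "S = (\<Union>p\<in>J. fst p)"
    define \<epsilon> where "\<epsilon> = Min (insert 1 (snd ` J))"
    have inI: "finite (fst p)" "fst p \<subseteq> carrier G" "snd p > 0" if "p \<in> J" for p
      using subsetD[OF J(2) that] by (auto simp: I_def)
    have S: "finite S" using J(1) inI(1) by (auto simp: S_def)
    have SG: "S \<subseteq> carrier G" unfolding S_def using inI(2) by blast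
    have "\<epsilon> > 0" unfolding \<epsilon>_def using J(1) inI(3) by (subst Min_gr_iff) auto
    have le: "\<epsilon> \<le> snd p" if "p \<in> J" for p
      unfolding \<epsilon>_def using J that by (intro Min_le) auto
    obtain F where F: "finite F" "F \<noteq> {}" "F \<subseteq> A"
      and small: "real (card ((\<Union>s\<in>S. (\<otimes>) s ` F) \<inter> A - F)) \<le> \<epsilon> * real (card F)"
      using folner[OF S SG \<open>\<epsilon> > 0\<close>] by blast
    let ?E = "(\<Union>s\<in>S. (\<otimes>) s ` F) \<inter> A - F"
    have cF: "0 < real (card F)" using F by (simp add: card_gt_0_iff)
    define m where "m B = real (card (B \<inter> F)) / real (card F)" for B
    have mU: "m \<in> U"
    proof -
      have "card (B \<inter> F) \<le> card F" for B by (rule card_mono) (use F in auto)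
      then show ?thesis using cF by (simp add: U_def PiE_UNIV_domain m_def)
    qed
    have one: "m A = 1" using F cF by (simp add: m_def Int_absorb1)
    have add: "m (B \<union> B') = m B + m B'" if "B \<inter> B' = {}" for B B'
    proof -
      have "card ((B \<inter> F) \<union> (B' \<inter> F)) = card (B \<inter> F) + card (B' \<inter> F)"
        by (rule card_Un_disjoint) (use F that in auto)
      then show ?thesis by (simp add: m_def Int_Un_distrib2 add_divide_distrib)
    qed
    have le_translate: "m B \<le> m ((\<otimes>) g ` B) + \<epsilon>" if g: "g \<in> S" and B: "B \<subseteq> A" "(\<otimes>) g ` B \<subseteq> A" for g B
    proof -
      have "card (B \<inter> F) = card ((\<otimes>) g ` (B \<inter> F))"
        by (rule card_image[symmetric], rule inj_on_left_translation) (use g SG A B in auto)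
      also have "\<dots> \<le> card ((((\<otimes>) g ` B) \<inter> F) \<union> ?E)"
        by (rule card_mono) (use F S g B in auto)
      also have "\<dots> \<le> card (((\<otimes>) g ` B) \<inter> F) + card ?E" by (rule card_Un_le)
      finally have "real (card (B \<inter> F)) \<le> real (card (((\<otimes>) g ` B) \<inter> F)) + \<epsilon> * real (card F)"
        using small by linarith
      then show ?thesis using cF by (simp add: m_def field_simps)
    qed
    have "m \<in> C p" if p: "p \<in> J" for p
    proof -
      have "m B \<le> m ((\<otimes>) g ` B) + snd p" if "g \<in> fst p" "B \<subseteq> A" "(\<otimes>) g ` B \<subseteq> A" for g B
      proof -
        have "g \<in> S" using p that(1) unfolding S_def by blast
        from le_translate[OF this that(2,3)] le[OF p] show ?thesis by linarith
      qed
      then show ?thesis unfolding C_def using one add by blast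
    qed
    with mU have "m \<in> U \<inter> (\<Inter>p\<in>J. C p)" by blast
    then show ?thesis by blast
  qed
  ultimately have "U \<inter> (\<Inter>p\<in>I. C p) \<noteq> {}" by (rule compact_imp_fip_image)
  then obtain m where U: "m \<in> U" and m: "\<And>p. p \<in> I \<Longrightarrow> m \<in> C p" by blast
  have "({}, 1) \<in> I" by (simp add: I_def)
  from m[OF this] have one: "m A = 1" and add: "\<And>B B'. B \<inter> B' = {} \<Longrightarrow> m (B \<union> B') = m B + m B'"
    by (auto simp: C_def)
  have le: "m B \<le> m ((\<otimes>) g ` B)" if g: "g \<in> carrier G" and B: "B \<subseteq> A" "(\<otimes>) g ` B \<subseteq> A" for g B
  proof (rule field_le_epsilon)
    fix \<epsilon> :: real assume "\<epsilon> > 0"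
    then have "({g}, \<epsilon>) \<in> I" using g by (simp add: I_def)
    from m[OF this] B show "m B \<le> m ((\<otimes>) g ` B) + \<epsilon>" by (simp add: C_def)
  qed
  have "m ((\<otimes>) g ` B) = m B" if g: "g \<in> carrier G" and B: "B \<subseteq> A" "(\<otimes>) g ` B \<subseteq> A" for g B
  proof (rule antisym)
    have "(\<otimes>) (inv g) ` ((\<otimes>) g ` B) = B"
      using B A g by (subst left_translate_twice) (auto simp: left_translate_one)
    then show "m ((\<otimes>) g ` B) \<le> m B" using le[of "inv g" "(\<otimes>) g ` B"] g B by simp
    show "m B \<le> m ((\<otimes>) g ` B)" by (rule le[OF that])
  qed
  moreover have "0 \<le> m B" for B using U by (auto simp: U_def PiE_def Pi_def)
  ultimately show thesis using that[of m] one add by blast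
qed

lemma left_translates_disjoint:
  assumes g: "g \<in> carrier G" and X: "X \<subseteq> carrier G" "Y \<subseteq> carrier G" and disj: "X \<inter> Y = {}"
  shows "(\<otimes>) g ` X \<inter> (\<otimes>) g ` Y = {}"
  using inj_on_image_Int[OF inj_on_left_translation[OF g subset_refl] X] disj by simp

text \<open>
  A packing of \<open>B\<close> into \<open>A\<close> consists of finitely many disjoint pieces of \<open>B\<close>, each of which is moved into
  \<open>A\<close> by the group element that indexes it. Different pieces may overlap after they have been moved. The
  pieces outside \<open>T\<close> are empty so that two packings can be united piecewise.
\<close>

definition packings :: "'a set \<Rightarrow> 'a set \<Rightarrow> ('a set \<times> ('a \<Rightarrow> 'a set)) set" where
  "packings A B = {(T, P). finite T \<and> T \<subseteq> carrier G \<and> (\<forall>g. g \<notin> T \<longrightarrow> P g = {}) \<and>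
     (\<forall>g h. g \<noteq> h \<longrightarrow> P g \<inter> P h = {}) \<and> (\<forall>g. P g \<subseteq> B) \<and> (\<forall>g. (\<otimes>) g ` P g \<subseteq> A)}"

text \<open>
  The largest total mean of a packing: the natural extension of \<open>m\<close> from subsets of \<open>A\<close> to all of the
  group. When \<open>m A = 1\<close> it is infinite on sets that contain arbitrarily many disjoint translates of \<open>A\<close>.
\<close>

definition packing_measure :: "('a set \<Rightarrow> real) \<Rightarrow> 'a set \<Rightarrow> 'a set \<Rightarrow> ennreal" where
  "packing_measure m A B = (SUP (T, P) \<in> packings A B. ennreal (\<Sum>g\<in>T. m ((\<otimes>) g ` P g)))"

lemma packingsI:
  assumes "finite T" "T \<subseteq> carrier G" "\<And>g. g \<notin> T \<Longrightarrow> P g = {}"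
    and "\<And>g h. g \<noteq> h \<Longrightarrow> P g \<inter> P h = {}" "\<And>g. P g \<subseteq> B" "\<And>g. (\<otimes>) g ` P g \<subseteq> A"
  shows "(T, P) \<in> packings A B"
  unfolding packings_def mem_Collect_eq case_prod_conv using assms by (intro conjI allI impI)

lemma packingsD:
  assumes "(T, P) \<in> packings A B"
  shows "finite T" "T \<subseteq> carrier G" "g \<notin> T \<Longrightarrow> P g = {}"
    and "g \<noteq> h \<Longrightarrow> P g \<inter> P h = {}" "P g \<subseteq> B" "(\<otimes>) g ` P g \<subseteq> A"
proof -
  have *: "finite T \<and> T \<subseteq> carrier G \<and> (\<forall>g. g \<notin> T \<longrightarrow> P g = {}) \<and>
      (\<forall>g h. g \<noteq> h \<longrightarrow> P g \<inter> P h = {}) \<and> (\<forall>g. P g \<subseteq> B) \<and> (\<forall>g. (\<otimes>) g ` P g \<subseteq> A)"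
    using assms unfolding packings_def mem_Collect_eq case_prod_conv .
  show "finite T" using * by (elim conjE)
  show "T \<subseteq> carrier G" using * by (elim conjE)
  show "P g = {}" if "g \<notin> T" using * that by (elim conjE) metis
  show "P g \<inter> P h = {}" if "g \<noteq> h" using * that by (elim conjE) metis
  show "P g \<subseteq> B" using * by (elim conjE) metis
  show "(\<otimes>) g ` P g \<subseteq> A" using * by (elim conjE) metis
qed

lemma packing_measure_upper:
  "(T, P) \<in> packings A B \<Longrightarrow> ennreal (\<Sum>g\<in>T. m ((\<otimes>) g ` P g)) \<le> packing_measure m A B"
  unfolding packing_measure_def by (intro SUP_upper2[of "(T, P)"]) auto

lemma packing_measure_least:
  assumes "\<And>T P. (T, P) \<in> packings A B \<Longrightarrow> ennreal (\<Sum>g\<in>T. m ((\<otimes>) g ` P g)) \<le> c"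
  shows "packing_measure m A B \<le> c"
  unfolding packing_measure_def using assms by (intro SUP_least) auto

text \<open>
  A packing \<open>P\<close> of \<open>B\<close> becomes a packing of \<open>h B\<close> with the same images in \<open>A\<close>: the piece \<open>h P t\<close> is moved
  by \<open>t (inv h)\<close>.
\<close>

lemma packing_measure_left_translate:
  assumes g: "g \<in> carrier G" and B: "B \<subseteq> carrier G"
  shows "packing_measure m A ((\<otimes>) g ` B) = packing_measure m A B"
proof -
  have le: "packing_measure m A B \<le> packing_measure m A ((\<otimes>) h ` B)"
    if h: "h \<in> carrier G" and B: "B \<subseteq> carrier G" for h B
  proof (rule packing_measure_least)
    fix T P assume P: "(T, P) \<in> packings A B"
    note T = packingsD(1,2)[OF P] and PB = packingsD(5)[OF P]
    define T' where "T' = (\<lambda>t. t \<otimes> inv h) ` T"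
    define Q where "Q g = (if g \<in> T' then (\<otimes>) h ` P (g \<otimes> h) else {})" for g
    have inj: "inj_on (\<lambda>t. t \<otimes> inv h) T"
      using h T by (auto simp: inj_on_def subset_iff)
    have Qt: "Q (t \<otimes> inv h) = (\<otimes>) h ` P t" if "t \<in> T" for t
    proof -
      have "t \<otimes> inv h \<otimes> h = t" using that T h by (simp add: m_assoc subset_iff)
      then show ?thesis using that by (simp add: Q_def T'_def)
    qed
    have tQ: "(\<otimes>) (t \<otimes> inv h) ` Q (t \<otimes> inv h) = (\<otimes>) t ` P t" if "t \<in> T" for t
    proof -
      have "t \<in> carrier G" using that T(2) by (rule subsetD[rotated])
      moreover have "P t \<subseteq> carrier G" by (rule subset_trans[OF PB B])
      ultimately show ?thesis using h by (simp add: Qt[OF that] left_translate_twice m_assoc)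
    qed
    have "(T', Q) \<in> packings A ((\<otimes>) h ` B)"
    proof (rule packingsI)
      show "finite T'" "T' \<subseteq> carrier G" using T h by (auto simp: T'_def)
      show "Q g = {}" if "g \<notin> T'" for g using that by (simp add: Q_def)
      show "Q g \<inter> Q g' = {}" if "g \<noteq> g'" for g g'
      proof (cases "g \<in> T' \<and> g' \<in> T'")
        case True
        then obtain t t' where t: "t \<in> T" "g = t \<otimes> inv h" and t': "t' \<in> T" "g' = t' \<otimes> inv h"
          unfolding T'_def by blast
        have "t \<noteq> t'" using that t(2) t'(2) by auto
        then have "P t \<inter> P t' = {}" by (rule packingsD(4)[OF P])
        then show ?thesis
          unfolding t(2) t'(2) Qt[OF t(1)] Qt[OF t'(1)]
          by (intro left_translates_disjoint h subset_trans[OF PB B])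
      qed (auto simp: Q_def)
      show "Q g \<subseteq> (\<otimes>) h ` B" for g
        using PB[of "g \<otimes> h"] by (auto simp: Q_def)
      show "(\<otimes>) g ` Q g \<subseteq> A" for g
      proof (cases "g \<in> T'")
        case True
        then obtain t where t: "t \<in> T" "g = t \<otimes> inv h" unfolding T'_def by blast
        show ?thesis unfolding t(2) tQ[OF t(1)] by (rule packingsD(6)[OF P])
      qed (simp add: Q_def)
    qed
    from packing_measure_upper[OF this, of m]
    show "ennreal (\<Sum>g\<in>T. m ((\<otimes>) g ` P g)) \<le> packing_measure m A ((\<otimes>) h ` B)"
      unfolding T'_def by (simp add: sum.reindex[OF inj] tQ)
  qed
  have gB: "(\<otimes>) g ` B \<subseteq> carrier G" using g B by auto
  have undo: "(\<otimes>) (inv g) ` (\<otimes>) g ` B = B"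
    using B g by (simp add: left_translate_twice left_translate_one)
  show ?thesis
    using le[OF g B] le[OF inv_closed[OF g] gB] unfolding undo by (rule antisym[rotated])
qed

text \<open>
  Every packing of the union splits into packings of the two parts, and conversely packings of
  disjoint sets can be united.
\<close>

lemma packing_measure_Un:
  fixes m :: "'a set \<Rightarrow> real"
  assumes nonneg: "\<And>B. 0 \<le> m B"
    and add: "\<And>B C. B \<inter> C = {} \<Longrightarrow> m (B \<union> C) = m B + m C"
    and BC: "B \<subseteq> carrier G" "C \<subseteq> carrier G" "B \<inter> C = {}"
  shows "packing_measure m A (B \<union> C) = packing_measure m A B + packing_measure m A C"
proof (rule antisym)
  have m_empty: "m {} = 0" using add[of "{}" "{}"] by simp
  have add_translates: "m ((\<otimes>) g ` (X \<union> Y)) = m ((\<otimes>) g ` X) + m ((\<otimes>) g ` Y)"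
    if "g \<in> carrier G" "X \<subseteq> B" "Y \<subseteq> C" for g X Y
  proof -
    have "X \<subseteq> carrier G" "Y \<subseteq> carrier G" "X \<inter> Y = {}" using that BC by blast+
    from add[OF left_translates_disjoint[OF that(1) this]] show ?thesis by (simp add: image_Un)
  qed
  show "packing_measure m A (B \<union> C) \<le> packing_measure m A B + packing_measure m A C"
  proof (rule packing_measure_least)
    fix T P assume P: "(T, P) \<in> packings A (B \<union> C)"
    have sub: "(T, \<lambda>g. P g \<inter> D) \<in> packings A D" for D
    proof (rule packingsI)
      show "finite T" "T \<subseteq> carrier G" by (rule packingsD[OF P])+
      show "P g \<inter> D = {}" if "g \<notin> T" for g using packingsD(3)[OF P that] by simp
      show "P g \<inter> D \<inter> (P h \<inter> D) = {}" if "g \<noteq> h" for g h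
        using packingsD(4)[OF P that] by blast
      show "(\<otimes>) g ` (P g \<inter> D) \<subseteq> A" for g using packingsD(6)[OF P, of g] by blast
    qed simp
    have "m ((\<otimes>) g ` P g) = m ((\<otimes>) g ` (P g \<inter> B)) + m ((\<otimes>) g ` (P g \<inter> C))" if "g \<in> T" for g
    proof -
      have "P g = P g \<inter> B \<union> P g \<inter> C" using packingsD(5)[OF P, of g] by blast
      then show ?thesis
        using add_translates[of g "P g \<inter> B" "P g \<inter> C"] that packingsD(2)[OF P] by auto
    qed
    then have "(\<Sum>g\<in>T. m ((\<otimes>) g ` P g)) =
        (\<Sum>g\<in>T. m ((\<otimes>) g ` (P g \<inter> B))) + (\<Sum>g\<in>T. m ((\<otimes>) g ` (P g \<inter> C)))"
      by (simp add: sum.distrib)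
    then have "ennreal (\<Sum>g\<in>T. m ((\<otimes>) g ` P g)) =
        ennreal (\<Sum>g\<in>T. m ((\<otimes>) g ` (P g \<inter> B))) + ennreal (\<Sum>g\<in>T. m ((\<otimes>) g ` (P g \<inter> C)))"
      using nonneg by (simp add: sum_nonneg)
    also have "\<dots> \<le> packing_measure m A B + packing_measure m A C"
      by (intro add_mono packing_measure_upper sub)
    finally show "ennreal (\<Sum>g\<in>T. m ((\<otimes>) g ` P g)) \<le>
        packing_measure m A B + packing_measure m A C" .
  qed
  have ne: "packings A D \<noteq> {}" for D
  proof -
    have "({}, \<lambda>_. {}) \<in> packings A D" by (rule packingsI) auto
    then show ?thesis by blast
  qed
  have pair: "ennreal (\<Sum>g\<in>T. m ((\<otimes>) g ` P g)) + ennreal (\<Sum>g\<in>T'. m ((\<otimes>) g ` P' g))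
      \<le> packing_measure m A (B \<union> C)"
    if P: "(T, P) \<in> packings A B" and P': "(T', P') \<in> packings A C" for T P T' P'
  proof -
    let ?Q = "\<lambda>g. P g \<union> P' g"
    have fin: "finite (T \<union> T')" using packingsD(1)[OF P] packingsD(1)[OF P'] by simp
    have Q: "(T \<union> T', ?Q) \<in> packings A (B \<union> C)"
    proof (rule packingsI)
      show "T \<union> T' \<subseteq> carrier G" using packingsD(2)[OF P] packingsD(2)[OF P'] by simp
      show "?Q g = {}" if "g \<notin> T \<union> T'" for g
        using that packingsD(3)[OF P, of g] packingsD(3)[OF P', of g] by simp
      show "?Q g \<inter> ?Q h = {}" if "g \<noteq> h" for g h
        using packingsD(4)[OF P that] packingsD(4)[OF P' that] BC(3)
          packingsD(5)[OF P, of g] packingsD(5)[OF P, of h]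
          packingsD(5)[OF P', of g] packingsD(5)[OF P', of h] by blast
      show "?Q g \<subseteq> B \<union> C" for g using packingsD(5)[OF P, of g] packingsD(5)[OF P', of g] by blast
      show "(\<otimes>) g ` ?Q g \<subseteq> A" for g
        using packingsD(6)[OF P, of g] packingsD(6)[OF P', of g] by (simp add: image_Un)
    qed (rule fin)
    have ext: "(\<Sum>g\<in>S. m ((\<otimes>) g ` R g)) = (\<Sum>g\<in>T \<union> T'. m ((\<otimes>) g ` R g))"
      if "(S, R) \<in> packings A D" "S \<subseteq> T \<union> T'" for S R D
      by (rule sum.mono_neutral_left[OF fin that(2)]) (use packingsD(3)[OF that(1)] m_empty in auto)
    have "(\<Sum>g\<in>T. m ((\<otimes>) g ` P g)) + (\<Sum>g\<in>T'. m ((\<otimes>) g ` P' g)) =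
        (\<Sum>g\<in>T \<union> T'. m ((\<otimes>) g ` P g) + m ((\<otimes>) g ` P' g))"
      by (simp add: ext[OF P] ext[OF P'] sum.distrib)
    also have "\<dots> = (\<Sum>g\<in>T \<union> T'. m ((\<otimes>) g ` ?Q g))"
      using packingsD(2,5)[OF P] packingsD(2,5)[OF P'] by (intro sum.cong add_translates[symmetric]) auto
    finally have "ennreal (\<Sum>g\<in>T. m ((\<otimes>) g ` P g)) + ennreal (\<Sum>g\<in>T'. m ((\<otimes>) g ` P' g)) =
        ennreal (\<Sum>g\<in>T \<union> T'. m ((\<otimes>) g ` ?Q g))"
      using nonneg by (simp add: sum_nonneg flip: ennreal_plus)
    then show ?thesis using packing_measure_upper[OF Q, of m] by simp
  qed
  have B_le: "packing_measure m A B + ennreal (\<Sum>g\<in>T'. m ((\<otimes>) g ` P' g))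
      \<le> packing_measure m A (B \<union> C)"
    if "(T', P') \<in> packings A C" for T' P'
    unfolding packing_measure_def[of m A B]
    by (subst ennreal_SUP_add_left[OF ne, symmetric], rule SUP_least) (use pair that in auto)
  show "packing_measure m A B + packing_measure m A C \<le> packing_measure m A (B \<union> C)"
    unfolding packing_measure_def[of m A C]
    by (subst ennreal_SUP_add_right[OF ne], rule SUP_least) (use B_le in auto)
qed

text \<open>
  For a packing of \<open>A\<close> into itself, partial invariance puts all pieces back where they came from; being
  disjoint, they have total mean at most \<open>m A\<close>.
\<close>

lemma packing_measure_self:
  fixes m :: "'a set \<Rightarrow> real"
  assumes A: "A \<subseteq> carrier G" and nonneg: "\<And>B. 0 \<le> m B"
    and add: "\<And>B C. B \<inter> C = {} \<Longrightarrow> m (B \<union> C) = m B + m C"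
    and inv: "\<And>g B. \<lbrakk>g \<in> carrier G; B \<subseteq> A; (\<otimes>) g ` B \<subseteq> A\<rbrakk> \<Longrightarrow> m ((\<otimes>) g ` B) = m B"
  shows "packing_measure m A A = ennreal (m A)"
proof (rule antisym)
  have m_empty: "m {} = 0" using add[of "{}" "{}"] by simp
  have mono: "m B \<le> m C" if "B \<subseteq> C" for B C
    using add[of B "C - B"] nonneg[of "C - B"] that by (simp add: Un_absorb1)
  show "packing_measure m A A \<le> ennreal (m A)"
  proof (rule packing_measure_least)
    fix T P assume P: "(T, P) \<in> packings A A"
    have "(\<Sum>g\<in>T. m ((\<otimes>) g ` P g)) = (\<Sum>g\<in>T. m (P g))"
      by (intro sum.cong refl inv packingsD(5,6)[OF P] subsetD[OF packingsD(2)[OF P]])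
    also have "\<dots> = m (\<Union>g\<in>T. P g)"
      using packingsD(1)[OF P]
    proof (induction T rule: finite_induct)
      case (insert t T)
      have "P t \<inter> P g = {}" if "g \<in> T" for g
        by (rule packingsD(4)[OF P]) (use that insert.hyps in auto)
      then have "P t \<inter> (\<Union>g\<in>T. P g) = {}" by blast
      with insert show ?case by (simp add: add)
    qed (simp add: m_empty)
    also have "\<dots> \<le> m A" by (intro mono UN_least packingsD(5)[OF P])
    finally show "ennreal (\<Sum>g\<in>T. m ((\<otimes>) g ` P g)) \<le> ennreal (m A)" by (rule ennreal_leI)
  qed
  have "({\<one>}, \<lambda>g. if g = \<one> then A else {}) \<in> packings A A"
    by (rule packingsI) (use A left_translate_one in \<open>auto split: if_splits\<close>)
  from packing_measure_upper[OF this, of m] show "ennreal (m A) \<le> packing_measure m A A"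
    using A by (simp add: left_translate_one)
qed

text \<open>
  A set \<open>A\<close> without an invariant measure normalised on it must expand: otherwise it contains finite sets
  with arbitrarily small relative boundary, and the mean that they produce extends to such a measure.
\<close>

lemma not_supramenable_expanding_subset:
  assumes "\<not> supramenable G"
  obtains A S \<epsilon> where "A \<subseteq> carrier G" "A \<noteq> {}" "finite S" "S \<subseteq> carrier G" "\<epsilon> > 0"
    and "\<And>F. \<lbrakk>finite F; F \<noteq> {}; F \<subseteq> A\<rbrakk> \<Longrightarrow>
      \<epsilon> * real (card F) \<le> real (card ((\<Union>s\<in>S. (\<otimes>) s ` F) \<inter> A - F))"
proof -
  note expanding = that
  obtain A where A: "A \<subseteq> carrier G" "A \<noteq> {}"
    and no: "\<nexists>\<mu> :: 'a set \<Rightarrow> ennreal.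
          positive (Pow (carrier G)) \<mu> \<and> additive (Pow (carrier G)) \<mu> \<and>
          (\<forall>g \<in> carrier G. \<forall>B \<subseteq> carrier G. \<mu> ((\<otimes>) g ` B) = \<mu> B) \<and> \<mu> A = 1"
    using assms unfolding supramenable_def l_coset_eq_left_translate by blast
  show thesis
  proof (rule ccontr)
    assume no_expansion: "\<not> thesis"
    have folner: "\<exists>F. finite F \<and> F \<noteq> {} \<and> F \<subseteq> A \<and>
        real (card ((\<Union>s\<in>S. (\<otimes>) s ` F) \<inter> A - F)) \<le> \<epsilon> * real (card F)"
      if S: "finite S" "S \<subseteq> carrier G" "\<epsilon> > 0" for S and \<epsilon> :: real
    proof (rule ccontr)
      assume *: "\<not> ?thesis"
      have "\<epsilon> * real (card F) \<le> real (card ((\<Union>s\<in>S. (\<otimes>) s ` F) \<inter> A - F))"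
        if "finite F" "F \<noteq> {}" "F \<subseteq> A" for F
        using * that by (meson linear)
      from expanding[OF A S this] no_expansion show False by blast
    qed
    obtain m :: "'a set \<Rightarrow> real" where m: "\<And>B. 0 \<le> m B" "m A = 1"
      "\<And>B C. B \<inter> C = {} \<Longrightarrow> m (B \<union> C) = m B + m C"
      "\<And>g B. \<lbrakk>g \<in> carrier G; B \<subseteq> A; (\<otimes>) g ` B \<subseteq> A\<rbrakk> \<Longrightarrow> m ((\<otimes>) g ` B) = m B"
      by (rule partially_invariant_mean[OF A(1)], erule (2) folner) (rule that)
    let ?\<mu> = "packing_measure m A"
    have "?\<mu> {} \<le> 0"
    proof (rule packing_measure_least)
      fix T P assume "(T, P) \<in> packings A {}"
      from packingsD(5)[OF this] m(3)[of "{}" "{}"]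
      show "ennreal (\<Sum>g\<in>T. m ((\<otimes>) g ` P g)) \<le> 0" by simp
    qed
    then have "positive (Pow (carrier G)) ?\<mu>" by (simp add: positive_def)
    moreover have "additive (Pow (carrier G)) ?\<mu>"
      unfolding additive_def by (intro ballI impI packing_measure_Un[OF m(1,3)]) auto
    moreover have "\<forall>g \<in> carrier G. \<forall>B \<subseteq> carrier G. ?\<mu> ((\<otimes>) g ` B) = ?\<mu> B"
      by (intro ballI allI impI packing_measure_left_translate)
    moreover have "?\<mu> A = 1" using packing_measure_self[OF A(1) m(1,3,4)] m(2) by simp
    ultimately have "\<exists>\<mu> :: 'a set \<Rightarrow> ennreal.
          positive (Pow (carrier G)) \<mu> \<and> additive (Pow (carrier G)) \<mu> \<and>
          (\<forall>g \<in> carrier G. \<forall>B \<subseteq> carrier G. \<mu> ((\<otimes>) g ` B) = \<mu> B) \<and> \<mu> A = 1"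
      by (intro exI[of _ ?\<mu>] conjI)
    then show False by (rule notE[OF no])
  qed
qed

end

section \<open>A uniform lower bound for the Macaev norm of the differences\<close>

theorem theorem2p1:
  fixes G :: "('a, 'm) monoid_scheme" and K :: "'a set"
  assumes "group G"
    and "finite K" and "K \<subseteq> carrier G" and "generate G K = carrier G"
    and "\<not> supramenable G"
  shows "(INF f \<in> {f \<in> finsupp_functions G. f \<one>\<^bsub>G\<^esub> = 1}.
            MAX g \<in> K. macaev_norm (carrier G) (\<lambda>x. right_translate G g f x - f x)) > 0"
proof -
  interpret group G by fact
  obtain A S \<epsilon> where A: "A \<subseteq> carrier G" "A \<noteq> {}" and S: "finite S" "S \<subseteq> carrier G"
    and eps: "\<epsilon> > 0"
    and expand: "\<And>F. \<lbrakk>finite F; F \<noteq> {}; F \<subseteq> A\<rbrakk> \<Longrightarrow>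
      \<epsilon> * real (card F) \<le> real (card ((\<Union>s\<in>S. (\<otimes>\<^bsub>G\<^esub>) s ` F) \<inter> A - F))"
    by (rule not_supramenable_expanding_subset[OF assms(5)]) (rule that)
  obtain a where a: "a \<in> A" using A(2) by blast
  then have ac: "a \<in> carrier G" using A(1) by blast
  have "\<forall>s\<in>S. \<exists>L :: nat. \<forall>f M. (\<forall>k\<in>K. weighted_variation_le G f k M) \<longrightarrow>
      weighted_variation_le G f (inv\<^bsub>G\<^esub> s) (of_nat L * M)"
    using S(2) assms(3,4) by (intro ballI weighted_variation_le_generate) auto
  then obtain L :: "'a \<Rightarrow> nat" where L: "\<And>s f M. \<lbrakk>s \<in> S; \<forall>k\<in>K. weighted_variation_le G f k M\<rbrakk> \<Longrightarrow>
      weighted_variation_le G f (inv\<^bsub>G\<^esub> s) (of_nat (L s) * M)"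
    using bchoice[of S "\<lambda>s L. \<forall>f M. (\<forall>k\<in>K. weighted_variation_le G f k M) \<longrightarrow>
      weighted_variation_le G f (inv\<^bsub>G\<^esub> s) (of_nat L * M)"] by blast
  define N where "N = (\<Sum>s\<in>S. L s)"
  \<comment> \<open>The successor only keeps the denominator positive.\<close>
  define c where "c = \<epsilon> / real (Suc N)"
  have bound: "ennreal c \<le> M"
    if f: "f \<in> finsupp_functions G" "f \<one>\<^bsub>G\<^esub> = 1"
      and M: "\<forall>k\<in>K. macaev_norm (carrier G) (\<lambda>x. right_translate G k f x - f x) \<le> M" for f M
  proof -
    have var_K: "\<forall>k\<in>K. weighted_variation_le G f k M"
    proof
      fix k assume k: "k \<in> K"
      then have "weighted_variation_le G f k
          (macaev_norm (carrier G) (\<lambda>x. right_translate G k f x - f x))"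
        using assms(3) f(1) by (intro weighted_variation_le_macaev_norm) auto
      then show "weighted_variation_le G f k M"
        using M k unfolding weighted_variation_le_def by (meson order_trans)
    qed
    \<comment> \<open>\<open>\<theta>\<close> turns left translations into right translations and takes \<open>a\<close> to the neutral element.\<close>
    define \<theta> where "\<theta> x = a \<otimes>\<^bsub>G\<^esub> inv\<^bsub>G\<^esub> x" for x
    have \<theta>_carrier: "\<theta> x \<in> carrier G" if "x \<in> carrier G" for x using that ac by (simp add: \<theta>_def)
    have inj: "inj_on \<theta> (carrier G)"
    proof (rule inj_onI)
      fix x y assume xy: "x \<in> carrier G" "y \<in> carrier G" "\<theta> x = \<theta> y"
      then have "inv\<^bsub>G\<^esub> x = inv\<^bsub>G\<^esub> y" using ac by (simp add: \<theta>_def)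
      with xy show "x = y" by (metis inv_inv)
    qed
    have \<theta>_mult: "\<theta> (s \<otimes>\<^bsub>G\<^esub> x) = \<theta> x \<otimes>\<^bsub>G\<^esub> inv\<^bsub>G\<^esub> s" if "s \<in> carrier G" "x \<in> carrier G" for s x
      using that ac by (simp add: \<theta>_def inv_mult_group m_assoc)
    define X where "X = {x \<in> A. f (\<theta> x) \<noteq> 0}"
    have XG: "X \<subseteq> carrier G" using A(1) by (auto simp: X_def)
    have injX: "inj_on \<theta> X" by (rule inj_on_subset[OF inj XG])
    have "\<theta> ` X \<subseteq> {x \<in> carrier G. f x \<noteq> 0}"
      using XG \<theta>_carrier by (auto simp: X_def)
    moreover have "finite {x \<in> carrier G. f x \<noteq> 0}"
      using f(1) by (simp add: finsupp_functions_def)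
    ultimately have "finite (\<theta> ` X)" by (rule finite_subset)
    then have finX: "finite X" by (rule finite_imageD[OF _ injX])
    obtain r :: "'a \<Rightarrow> nat" where r: "inj_on r X" and total: "\<epsilon> * \<bar>f (\<theta> a)\<bar> \<le>
        (\<Sum>s\<in>S. \<Sum>x\<in>X. \<bar>f (\<theta> (s \<otimes>\<^bsub>G\<^esub> x)) - f (\<theta> x)\<bar> / real (Suc (r x)))"
      unfolding X_def
      by (rule isoperimetric_weighted_variation[OF S(1) finX[unfolded X_def] a less_imp_le[OF eps]],
          erule (2) expand) (rule that[unfolded X_def])
    have step: "ennreal (\<Sum>x\<in>X. \<bar>f (\<theta> (s \<otimes>\<^bsub>G\<^esub> x)) - f (\<theta> x)\<bar> / real (Suc (r x)))
        \<le> of_nat (L s) * M" if s: "s \<in> S" for s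
    proof -
      define r' where "r' = r \<circ> inv_into X \<theta>"
      have r'\<theta>: "r' (\<theta> x) = r x" if "x \<in> X" for x using that injX by (simp add: r'_def)
      have "(\<Sum>x\<in>X. \<bar>f (\<theta> (s \<otimes>\<^bsub>G\<^esub> x)) - f (\<theta> x)\<bar> / real (Suc (r x))) =
          (\<Sum>x\<in>X. \<bar>f (\<theta> x \<otimes>\<^bsub>G\<^esub> inv\<^bsub>G\<^esub> s) - f (\<theta> x)\<bar> / real (Suc (r' (\<theta> x))))"
        using s S(2) XG by (intro sum.cong refl) (auto simp: \<theta>_mult r'\<theta> subset_iff)
      also have "\<dots> = (\<Sum>y\<in>\<theta> ` X. \<bar>f (y \<otimes>\<^bsub>G\<^esub> inv\<^bsub>G\<^esub> s) - f y\<bar> / real (Suc (r' y)))"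
        by (simp add: sum.reindex[OF injX])
      finally have eq: "(\<Sum>x\<in>X. \<bar>f (\<theta> (s \<otimes>\<^bsub>G\<^esub> x)) - f (\<theta> x)\<bar> / real (Suc (r x))) =
        (\<Sum>y\<in>\<theta> ` X. \<bar>f (y \<otimes>\<^bsub>G\<^esub> inv\<^bsub>G\<^esub> s) - f y\<bar> / real (Suc (r' y)))" .
      have "inj_on r' (\<theta> ` X)" using r by (auto simp: inj_on_def r'\<theta>)
      moreover have "\<theta> ` X \<subseteq> carrier G" using XG \<theta>_carrier by blast
      ultimately show ?thesis
        unfolding eq using L[OF s var_K] finX by (simp add: weighted_variation_le_def)
    qed
    have "\<theta> a = \<one>\<^bsub>G\<^esub>" using ac by (simp add: \<theta>_def)
    then have "ennreal \<epsilon> \<le> ennreal (\<Sum>s\<in>S. \<Sum>x\<in>X.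
        \<bar>f (\<theta> (s \<otimes>\<^bsub>G\<^esub> x)) - f (\<theta> x)\<bar> / real (Suc (r x)))"
      using total f(2) by (intro ennreal_leI) simp
    also have "\<dots> = (\<Sum>s\<in>S. ennreal (\<Sum>x\<in>X.
        \<bar>f (\<theta> (s \<otimes>\<^bsub>G\<^esub> x)) - f (\<theta> x)\<bar> / real (Suc (r x))))"
      by (rule sum_ennreal[symmetric]) (auto intro!: sum_nonneg)
    also have "\<dots> \<le> (\<Sum>s\<in>S. of_nat (L s) * M)" by (rule sum_mono) (rule step)
    also have "\<dots> = of_nat N * M" by (simp add: N_def sum_distrib_right)
    also have "\<dots> \<le> of_nat (Suc N) * M" by (intro mult_right_mono) auto
    finally have main: "ennreal \<epsilon> \<le> of_nat (Suc N) * M" .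
    show "ennreal c \<le> M"
    proof (cases M)
      case (real m)
      have "of_nat (Suc N) * M = ennreal (real (Suc N) * m)"
        unfolding real(2) ennreal_of_nat_eq_real_of_nat using real(1) by (simp only: ennreal_mult of_nat_0_le_iff)
      with main have "\<epsilon> \<le> real (Suc N) * m"
        using real(1) by (simp only: ennreal_le_iff mult_nonneg_nonneg of_nat_0_le_iff)
      then have "c \<le> m" by (simp add: c_def field_simps)
      then show ?thesis unfolding real(2) by (rule ennreal_leI)
    qed simp
  qed
  have "0 < ennreal c" using eps by (simp add: c_def)
  also have "ennreal c \<le> (INF f \<in> {f \<in> finsupp_functions G. f \<one>\<^bsub>G\<^esub> = 1}.
      MAX g \<in> K. macaev_norm (carrier G) (\<lambda>x. right_translate G g f x - f x))"
  proof (rule INF_greatest)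
    fix f assume "f \<in> {f \<in> finsupp_functions G. f \<one>\<^bsub>G\<^esub> = 1}"
    \<comment> \<open>If \<open>K\<close> is empty, the maximum is an unspecified value; \<open>bound\<close> then holds for every \<open>M\<close>, hence for it.\<close>
    then show "ennreal c \<le> (MAX g \<in> K. macaev_norm (carrier G) (\<lambda>x. right_translate G g f x - f x))"
      using assms(2) by (intro bound[of f] ballI Max_ge) auto
  qed
  finally show ?thesis .
qed

end
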